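(* Let $B$ be a nucleation process and $G$ a growth process on $[t_0,T]$, let $t\in[t_0,T]$ and let $\Pi,\Pi'$ be two partitions of $[t_0,t]$ such that $\Pi'$ is a refinement of $\Pi$ (every point of $\Pi$ is a point of $\Pi'$). Then, almost surely, $s_\Pi(t)\subseteq s_{\Pi'}(t)$ and $S_{\Pi'}(t)\subseteq S_\Pi(t)$.
   Context: Setting. $\mathfrak X$ is a reflexive Banach space with separable dual; $[t_0,T]\subset\mathbb R$; $(\Omega,\mathfrak F,\{\mathfrak F_t\}_{t\in[t_0,T]},\mathbb P)$ is a filtered complete probability space satisfying the usual conditions. $\mathbb F(\mathfrak X)$ is the family of non-empty closed subsets of $\mathfrak X$. A set-valued map $X$ defined on a measurable space $(E,\mathcal E)$ with values in subsets of $\mathfrak X$ is measurable if $\{e: X(e)\cap O\neq\emptyset\}\in\mathcal E$ for every open $O\subseteq\mathfrak X$. Nucleation process: a map $B:\Omega\times[t_0,T]\to\mathbb F(\mathfrak X)$, $B_t=B(\cdot,t)$, such that $B_t$ is $\mathfrak F_t$-measurable for every $t$, and $B_s\subseteq B_t$ whenever $s<t$. Growth process: a map $G:\Omega\times[t_0,T]\to\mathbb F(\mathfrak X)$ such that for all $(\omega,t)$: $0\in G(\omega,t)$, $G(\omega,t)$ is convex, $G(\omega,t)\subseteq K$ for a fixed non-empty closed bounded set $K\subset\mathfrak X$ (independent of $\omega,t$), and $G$ is measurable with respect to the predictable $\sigma$-algebra $\mathcal P$ on $\Omega\times[t_0,T]$, i.e. the $\sigma$-algebra generated by the sets $A\times\{t_0\}$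 with $A\in\mathfrak F_{t_0}$ and $A\times(s,t]$ with $A\in\mathfrak F_s$, $(s,t]\subset[t_0,T]$. For $a\le b$, $\int_a^b G(\tau)\,d\tau$ is the random set $\omega\mapsto\int_a^bG(\omega,\tau)\,d\tau$, the Aumann integral with respect to Lebesgue measure: $\{\int_a^b g(\tau)\,d\tau: g \text{ Bochner integrable on }[t_0,T],\ g(\tau)\in G(\omega,\tau)\text{ for a.e. }\tau\}$. Minkowski sum: $A+C=\{a+c:a\in A,c\in C\}$ (with $\emptyset+A=\emptyset$), and $A\oplus C=\overline{A+C}$. A partition of $[t_0,t]$ is $\Pi=(t_i)_{i=0}^n$ with $t_0<t_1<\dots<t_n=t$. Put $\Delta B_{t_i}=B_{t_i}\setminus B_{t_{i-1}}^{o}$, where $B^{o}$ is the interior of $B$, and $$s_\Pi(t)=\Big(B_{t_0}\oplus\int_{t_0}^tG(\tau)d\tau\Big)\cup\bigcup_{i=1}^n\Big(\Delta B_{t_i}\oplus\int_{t_i}^tG(\tau)d\tau\Big),$$ $$S_\Pi(t)=\Big(B_{t_0}\oplus\int_{t_0}^tG(\tau)d\tau\Big)\cup\bigcup_{i=1}^n\Big(\Delta B_{t_i}\oplus\int_{t_{i-1}}^tG(\tau)d\tau\Big).$$ *)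

theory Defs
  imports "HOL-Probability.Probability"
begin

definition bidual_embedding ::
    "'a::real_normed_vector \<Rightarrow> ('a \<Rightarrow>\<^sub>L real) \<Rightarrow>\<^sub>L real" where
  "bidual_embedding x = Blinfun (\<lambda>f. blinfun_apply f x)"

lemma bidual_embedding_apply:
  "blinfun_apply (bidual_embedding x) f = blinfun_apply f x"
  unfolding bidual_embedding_def
  by (simp add: bounded_linear_Blinfun_apply blinfun.bounded_linear_left)

definition reflexive_normed_space :: "'a::real_normed_vector itself \<Rightarrow> bool" where
  "reflexive_normed_space _ \<longleftrightarrow>
     surj (bidual_embedding :: 'a \<Rightarrow> ('a \<Rightarrow>\<^sub>L real) \<Rightarrow>\<^sub>L real)"

definition separable_dual :: "'a::real_normed_vector itself \<Rightarrow> bool" where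
  "separable_dual _ \<longleftrightarrow> separable_space (euclidean :: ('a \<Rightarrow>\<^sub>L real) topology)"

(* Only the values of the filtration F on the index set {t0..T} are constrained.
   usual_null and right_continuous are the usual conditions. *)
locale filtered_complete_prob_space =
  prob_space M + complete_measure M
  for M :: "'w measure" and F :: "real \<Rightarrow> 'w measure" and t0 T :: real +
  assumes subalgebra: "\<And>t. t \<in> {t0..T} \<Longrightarrow> subalgebra M (F t)"
    and sets_mono: "\<And>s t. t0 \<le> s \<Longrightarrow> s \<le> t \<Longrightarrow> t \<le> T \<Longrightarrow> sets (F s) \<subseteq> sets (F t)"
    and right_continuous:
      "\<And>t. t0 \<le> t \<Longrightarrow> t < T \<Longrightarrow> sets (F t) = (\<Inter>s\<in>{t<..T}. sets (F s))"
    and usual_null: "null_sets M \<subseteq> sets (F t0)"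

definition predictable_sigma ::
    "'w measure \<Rightarrow> (real \<Rightarrow> 'w measure) \<Rightarrow> real \<Rightarrow> real \<Rightarrow> ('w \<times> real) measure" where
  "predictable_sigma M F t0 T = sigma (space M \<times> {t0..T})
     ({A \<times> {t0} | A. A \<in> sets (F t0)} \<union>
      {A \<times> {s<..t} | A s t. t0 \<le> s \<and> s < t \<and> t \<le> T \<and> A \<in> sets (F s)})"

definition set_valued_measurable ::
    "'e measure \<Rightarrow> ('e \<Rightarrow> 'a::topological_space set) \<Rightarrow> bool" where
  "set_valued_measurable E X \<longleftrightarrow>
     (\<forall>U. open U \<longrightarrow> {e \<in> space E. X e \<inter> U \<noteq> {}} \<in> sets E)"

definition nucleation_process ::
    "'w measure \<Rightarrow> (real \<Rightarrow> 'w measure) \<Rightarrow> real \<Rightarrow> real \<Rightarrow>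
     ('w \<Rightarrow> real \<Rightarrow> 'a::topological_space set) \<Rightarrow> bool" where
  "nucleation_process M F t0 T B \<longleftrightarrow>
     (\<forall>\<omega>\<in>space M. \<forall>t\<in>{t0..T}. closed (B \<omega> t) \<and> B \<omega> t \<noteq> {}) \<and>
     (\<forall>t\<in>{t0..T}. set_valued_measurable (F t) (\<lambda>\<omega>. B \<omega> t)) \<and>
     (\<forall>\<omega>\<in>space M. \<forall>s\<in>{t0..T}. \<forall>t\<in>{t0..T}. s < t \<longrightarrow> B \<omega> s \<subseteq> B \<omega> t)"

definition growth_process ::
    "'w measure \<Rightarrow> (real \<Rightarrow> 'w measure) \<Rightarrow> real \<Rightarrow> real \<Rightarrow>
     ('w \<Rightarrow> real \<Rightarrow> 'a::real_normed_vector set) \<Rightarrow> bool" where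
  "growth_process M F t0 T G \<longleftrightarrow>
     (\<forall>\<omega>\<in>space M. \<forall>t\<in>{t0..T}. closed (G \<omega> t) \<and> G \<omega> t \<noteq> {}) \<and>
     (\<forall>\<omega>\<in>space M. \<forall>t\<in>{t0..T}. 0 \<in> G \<omega> t \<and> convex (G \<omega> t)) \<and>
     (\<exists>K. K \<noteq> {} \<and> closed K \<and> bounded K \<and>
          (\<forall>\<omega>\<in>space M. \<forall>t\<in>{t0..T}. G \<omega> t \<subseteq> K)) \<and>
     set_valued_measurable (predictable_sigma M F t0 T) (\<lambda>(\<omega>, t). G \<omega> t)"

(* The selections g live on the whole index interval {t0..T}, not just on {a..b}.
   The class second_countable_topology is what the Bochner integral of the library requires;
   for a Banach space with separable dual it is no restriction. *)
definition aumann_integral ::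
    "real \<Rightarrow> real \<Rightarrow> (real \<Rightarrow> 'a::{banach, second_countable_topology} set) \<Rightarrow>
     real \<Rightarrow> real \<Rightarrow> 'a set" where
  "aumann_integral t0 T H a b =
     {(LINT \<tau>:{a..b}|lebesgue. g \<tau>) | g.
        set_integrable lebesgue {t0..T} g \<and> (AE \<tau>\<in>{t0..T} in lebesgue. g \<tau> \<in> H \<tau>)}"

(* A + C is the elementwise sum of sets from HOL-Library.Set_Algebras. *)
definition closed_minkowski_sum ::
    "'a::real_normed_vector set \<Rightarrow> 'a set \<Rightarrow> 'a set" (infixl "\<oplus>\<^sub>c" 65) where
  "A \<oplus>\<^sub>c C = closure (A + C)"

(* The points p 0 < ... < p n; n = 0 is possible only for t = t0. *)
definition is_partition :: "real \<Rightarrow> real \<Rightarrow> nat \<Rightarrow> (nat \<Rightarrow> real) \<Rightarrow> bool" where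
  "is_partition t0 t n p \<longleftrightarrow> p 0 = t0 \<and> p n = t \<and> strict_mono_on {0..n} p"

definition is_refinement ::
    "nat \<Rightarrow> (nat \<Rightarrow> real) \<Rightarrow> nat \<Rightarrow> (nat \<Rightarrow> real) \<Rightarrow> bool" where
  "is_refinement m q n p \<longleftrightarrow> p ` {0..n} \<subseteq> q ` {0..m}"

definition nucleation_increment ::
    "('w \<Rightarrow> real \<Rightarrow> 'a::topological_space set) \<Rightarrow> (nat \<Rightarrow> real) \<Rightarrow> nat \<Rightarrow> 'w \<Rightarrow> 'a set" where
  "nucleation_increment B p i \<omega> = B \<omega> (p i) - interior (B \<omega> (p (i - 1)))"

definition lower_approx ::
    "real \<Rightarrow> real \<Rightarrow> ('w \<Rightarrow> real \<Rightarrow> 'a::{banach, second_countable_topology} set) \<Rightarrow>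
     ('w \<Rightarrow> real \<Rightarrow> 'a set) \<Rightarrow> nat \<Rightarrow> (nat \<Rightarrow> real) \<Rightarrow> real \<Rightarrow> 'w \<Rightarrow> 'a set" where
  "lower_approx t0 T B G n p t \<omega> =
     (B \<omega> t0 \<oplus>\<^sub>c aumann_integral t0 T (G \<omega>) t0 t) \<union>
     (\<Union>i\<in>{1..n}. nucleation_increment B p i \<omega> \<oplus>\<^sub>c aumann_integral t0 T (G \<omega>) (p i) t)"

definition upper_approx ::
    "real \<Rightarrow> real \<Rightarrow> ('w \<Rightarrow> real \<Rightarrow> 'a::{banach, second_countable_topology} set) \<Rightarrow>
     ('w \<Rightarrow> real \<Rightarrow> 'a set) \<Rightarrow> nat \<Rightarrow> (nat \<Rightarrow> real) \<Rightarrow> real \<Rightarrow> 'w \<Rightarrow> 'a set" where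
  "upper_approx t0 T B G n p t \<omega> =
     (B \<omega> t0 \<oplus>\<^sub>c aumann_integral t0 T (G \<omega>) t0 t) \<union>
     (\<Union>i\<in>{1..n}. nucleation_increment B p i \<omega> \<oplus>\<^sub>c aumann_integral t0 T (G \<omega>) (p (i - 1)) t)"

end

theory Submission
  imports Defs
begin

text \<open>The inclusions hold for every outcome. Since \<open>0 \<in> G\<close>, cutting a selection off to \<open>0\<close> before
  a later starting time leaves a selection, so the Aumann integral over \<open>{a..t}\<close> decreases in \<open>a\<close>.
  For the lower approximation, a point of \<open>B\<close> at a time \<open>p i = q k\<close> of the coarse partition is
  assigned to the first time \<open>q l\<close> of the fine partition at which it belongs to \<open>B\<close>, from which it
  grows for longer. For the upper approximation, each interval of the fine partition lies in an
  interval of the coarse one, which has a larger increment and an earlier starting time.\<close>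

lemma aumann_integral_antimono:
  fixes H :: "real \<Rightarrow> 'a::{banach, second_countable_topology} set"
  assumes "a \<le> b" and zero: "\<And>\<tau>. \<tau> \<in> {t0..T} \<Longrightarrow> 0 \<in> H \<tau>"
  shows "aumann_integral t0 T H b c \<subseteq> aumann_integral t0 T H a c"
proof
  fix x
  assume "x \<in> aumann_integral t0 T H b c"
  then obtain g where x: "x = (LINT \<tau>:{b..c}|lebesgue. g \<tau>)"
    and g: "set_integrable lebesgue {t0..T} g"
    and sel: "AE \<tau>\<in>{t0..T} in lebesgue. g \<tau> \<in> H \<tau>"
    unfolding aumann_integral_def by blast
  \<comment> \<open>Cutting off on \<open>{b..}\<close> rather than \<open>{b..c}\<close> suffices:
    \<open>h\<close> only has to agree with \<open>g\<close> on \<open>{b..c}\<close> and vanish on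
    \<open>{a..<b}\<close>, while its values after \<open>c\<close> do not enter the
    integral.\<close>
  define h where "h = (\<lambda>\<tau>. indicator {b..} \<tau> *\<^sub>R g \<tau>)"
  have "set_integrable lebesgue ({t0..T} \<inter> {b..}) g"
    by (rule set_integrable_subset[OF g]) auto
  then have "set_integrable lebesgue {t0..T} h"
    unfolding set_integrable_def h_def indicator_inter_arith scaleR_scaleR .
  moreover have "AE \<tau>\<in>{t0..T} in lebesgue. h \<tau> \<in> H \<tau>"
    \<comment> \<open>Where the indicator vanishes, \<open>h\<close> takes the value 0, which
      \<open>zero\<close> puts into \<open>H\<close>.\<close>
    using sel by eventually_elim (auto simp: h_def indicator_def zero)
  moreover have "x = (LINT \<tau>:{a..c}|lebesgue. h \<tau>)"
    unfolding x set_lebesgue_integral_def h_def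
    by (rule Bochner_Integration.integral_cong) (use \<open>a \<le> b\<close> in \<open>auto simp: indicator_def\<close>)
  ultimately show "x \<in> aumann_integral t0 T H a c"
    unfolding aumann_integral_def by blast
qed

lemma closed_minkowski_sum_mono:
  assumes "A \<subseteq> A'" and "C \<subseteq> C'"
  shows "A \<oplus>\<^sub>c C \<subseteq> A' \<oplus>\<^sub>c C'"
  unfolding closed_minkowski_sum_def by (intro closure_mono set_plus_mono2 assms)

lemma partition_less:
  assumes "is_partition t0 t n p" and "i < j" and "j \<le> n"
  shows "p i < p j"
  using assms unfolding is_partition_def strict_mono_on_def by auto

lemma partition_less_iff:
  assumes "is_partition t0 t n p" and "i \<le> n" and "j \<le> n"
  shows "p i < p j \<longleftrightarrow> i < j"
  using assms(2,3) partition_less[OF assms(1)] by (cases i j rule: linorder_cases) (auto dest: order_less_asym)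

lemma partition_range:
  assumes "is_partition t0 t n p" and "i \<le> n"
  shows "p i \<in> {t0..t}"
proof -
  have "p 0 = t0" "p n = t"
    using assms(1) unfolding is_partition_def by auto
  then show ?thesis
    using partition_less_iff[OF assms(1), of i 0] partition_less_iff[OF assms(1), of n i] assms(2)
    by force
qed

lemma nucleation_process_mono:
  assumes "nucleation_process M F t0 T B" and "\<omega> \<in> space M"
    and "t0 \<le> r" and "r \<le> s" and "s \<le> T"
  shows "B \<omega> r \<subseteq> B \<omega> s"
proof (cases "r = s")
  case False
  then have "r < s" "r \<in> {t0..T}" "s \<in> {t0..T}"
    using assms(3-5) by auto
  then show ?thesis
    using assms(1,2) unfolding nucleation_process_def by blast
qed simp

lemma growth_process_zero:
  assumes "growth_process M F t0 T G" and "\<omega> \<in> space M" and "\<tau> \<in> {t0..T}"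
  shows "0 \<in> G \<omega> \<tau>"
  using assms unfolding growth_process_def by blast

text \<open>A finite union of closures is closed. Hence an inclusion of a closed Minkowski sum in
  the lower approximation need only be checked on sums \<open>x + y\<close>, not on their
  limits.\<close>

lemma lower_approx_closed: "closed (lower_approx t0 T B G n p t \<omega>)"
  unfolding lower_approx_def closed_minkowski_sum_def
  by (intro closed_Un closed_UN closed_closure ballI) simp_all

text \<open>Taking all of \<open>B\<close> at time \<open>q k\<close>, instead of an increment,
  removes the coarse partition from the claim: each coarse increment at \<open>p i = q k\<close>
  lies in this set.\<close>

lemma nucleation_growth_subset_lower_approx:
  assumes zero: "\<And>\<tau>. \<tau> \<in> {t0..T} \<Longrightarrow> 0 \<in> G \<omega> \<tau>"
    and q: "is_partition t0 t m q" and "k \<le> m"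
  shows "B \<omega> (q k) \<oplus>\<^sub>c aumann_integral t0 T (G \<omega>) (q k) t \<subseteq> lower_approx t0 T B G m q t \<omega>"
proof -
  have "x + y \<in> lower_approx t0 T B G m q t \<omega>"
    if x: "x \<in> B \<omega> (q k)" and y: "y \<in> aumann_integral t0 T (G \<omega>) (q k) t" for x y
  proof -
    \<comment> \<open>The index \<open>k\<close> itself qualifies, so the least one exists and
      satisfies \<open>l \<le> k \<le> m\<close>.\<close>
    define l where "l = (LEAST l. x \<in> B \<omega> (q l))"
    have xl: "x \<in> B \<omega> (q l)" and "l \<le> k"
      unfolding l_def using x by (rule LeastI, rule Least_le)
    have first: "x \<notin> B \<omega> (q j)" if "j < l" for j
      using that not_less_Least unfolding l_def by blast
    have "q l \<le> q k"
      using partition_less_iff[OF q, of k l] \<open>l \<le> k\<close> \<open>k \<le> m\<close> by auto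
    then have yl: "y \<in> aumann_integral t0 T (G \<omega>) (q l) t"
      using aumann_integral_antimono[where H = "G \<omega>", OF _ zero] y by blast
    show ?thesis
    proof (cases "l = 0")
      case True
      have "q 0 = t0"
        using q unfolding is_partition_def by blast
      then have "x + y \<in> B \<omega> t0 \<oplus>\<^sub>c aumann_integral t0 T (G \<omega>) t0 t"
        unfolding closed_minkowski_sum_def
        using True xl yl by (auto intro!: closure_subset[THEN subsetD] set_plus_intro)
      then show ?thesis
        unfolding lower_approx_def by blast
    next
      case False
      \<comment> \<open>By minimality \<open>x\<close> is outside
        \<open>B \<omega> (q (l - 1))\<close>, hence outside its interior. Here
        \<open>l \<noteq> 0\<close> makes \<open>l - 1\<close> a true predecessor; the case
        \<open>l = 0\<close> belongs to the initial term.\<close>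
      then have "x \<in> nucleation_increment B q l \<omega>"
        unfolding nucleation_increment_def
        using xl first[of "l - 1"] interior_subset by auto
      then have "x + y \<in> nucleation_increment B q l \<omega> \<oplus>\<^sub>c aumann_integral t0 T (G \<omega>) (q l) t"
        unfolding closed_minkowski_sum_def
        using yl by (auto intro!: closure_subset[THEN subsetD] set_plus_intro)
      moreover have "l \<in> {1..m}"
        using False \<open>l \<le> k\<close> \<open>k \<le> m\<close> by auto
      ultimately show ?thesis
        unfolding lower_approx_def by blast
    qed
  qed
  then show ?thesis
    unfolding closed_minkowski_sum_def
    by (intro closure_minimal lower_approx_closed) (auto elim!: set_plus_elim)
qed

lemma lower_approx_refinement:
  assumes zero: "\<And>\<tau>. \<tau> \<in> {t0..T} \<Longrightarrow> 0 \<in> G \<omega> \<tau>"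
    and q: "is_partition t0 t m q" and "is_refinement m q n p"
  shows "lower_approx t0 T B G n p t \<omega> \<subseteq> lower_approx t0 T B G m q t \<omega>"
proof -
  have "nucleation_increment B p i \<omega> \<oplus>\<^sub>c aumann_integral t0 T (G \<omega>) (p i) t
      \<subseteq> lower_approx t0 T B G m q t \<omega>" if "i \<in> {1..n}" for i
  proof -
    have "p i \<in> q ` {0..m}"
      using \<open>is_refinement m q n p\<close> that unfolding is_refinement_def by auto
    then obtain k where "k \<le> m" "p i = q k"
      by auto
    moreover have "nucleation_increment B p i \<omega> \<subseteq> B \<omega> (p i)"
      unfolding nucleation_increment_def by blast
    ultimately show ?thesis
      using order_trans[OF closed_minkowski_sum_mono[OF _ order_refl]
          nucleation_growth_subset_lower_approx[of t0 T G \<omega>, OF zero q \<open>k \<le> m\<close>]]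
      by simp
  qed
  moreover have "B \<omega> t0 \<oplus>\<^sub>c aumann_integral t0 T (G \<omega>) t0 t \<subseteq> lower_approx t0 T B G m q t \<omega>"
    unfolding lower_approx_def by blast
  ultimately show ?thesis
    unfolding lower_approx_def[of t0 T B G n] by blast
qed

text \<open>All coarse points are fine points, so none lies strictly between two consecutive fine
  points.\<close>

lemma refinement_interval:
  assumes p: "is_partition t0 t n p" and q: "is_partition t0 t m q"
    and "is_refinement m q n p" and l: "l \<in> {1..m}"
  obtains i where "i \<in> {1..n}" and "p (i - 1) \<le> q (l - 1)" and "q l \<le> p i"
proof -
  have "p 0 = t0" "p n = t" "q 0 = t0"
    using p q unfolding is_partition_def by auto
  \<comment> \<open>The first coarse point at or after \<open>q l\<close>; one exists because
    \<open>p n = t\<close>.\<close>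
  define i where "i = (LEAST i. q l \<le> p i)"
  have "q l \<le> p n"
    using partition_range[OF q, of l] l \<open>p n = t\<close> by auto
  then have i: "q l \<le> p i" "i \<le> n"
    unfolding i_def by (rule LeastI, rule Least_le)
  have "t0 < q l"
    using partition_less[OF q, of 0 l] l \<open>q 0 = t0\<close> by auto
  \<comment> \<open>Without this, truncated subtraction would give \<open>i - 1 = i\<close>, and
    minimality would say nothing about \<open>p (i - 1)\<close>.\<close>
  then have "i \<noteq> 0"
    using i \<open>p 0 = t0\<close> by (metis not_less)
  then have "p (i - 1) < q l"
    using not_less_Least[of "i - 1" "\<lambda>i. q l \<le> p i"] unfolding i_def by auto
  \<comment> \<open>Being a fine point \<open>q j\<close> before \<open>q l\<close>, the point
    \<open>p (i - 1)\<close> has index \<open>j \<le> l - 1\<close>, which sharpens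
    \<open>p (i - 1) < q l\<close> to the bound by \<open>q (l - 1)\<close>.\<close>
  moreover have "p (i - 1) \<in> q ` {0..m}"
    using \<open>is_refinement m q n p\<close> i(2) unfolding is_refinement_def by auto
  then obtain j where j: "j \<le> m" "p (i - 1) = q j"
    by auto
  ultimately have "j < l"
    using partition_less_iff[OF q, of j l] l by auto
  then have "p (i - 1) \<le> q (l - 1)"
    using partition_less_iff[OF q, of "l - 1" j] j l by (auto simp flip: not_less)
  then show thesis
    using that[of i] i \<open>i \<noteq> 0\<close> by auto
qed

lemma upper_approx_refinement:
  assumes zero: "\<And>\<tau>. \<tau> \<in> {t0..T} \<Longrightarrow> 0 \<in> G \<omega> \<tau>"
    and mono: "\<And>r s. t0 \<le> r \<Longrightarrow> r \<le> s \<Longrightarrow> s \<le> T \<Longrightarrow> B \<omega> r \<subseteq> B \<omega> s"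
    and "t \<le> T" and p: "is_partition t0 t n p" and q: "is_partition t0 t m q"
    and ref: "is_refinement m q n p"
  shows "upper_approx t0 T B G m q t \<omega> \<subseteq> upper_approx t0 T B G n p t \<omega>"
proof -
  have "nucleation_increment B q l \<omega> \<oplus>\<^sub>c aumann_integral t0 T (G \<omega>) (q (l - 1)) t
      \<subseteq> upper_approx t0 T B G n p t \<omega>" if l: "l \<in> {1..m}" for l
  proof -
    obtain i where i: "i \<in> {1..n}" "p (i - 1) \<le> q (l - 1)" "q l \<le> p i"
      using refinement_interval[OF p q ref l] .
    have range: "p (i - 1) \<in> {t0..t}" "p i \<in> {t0..t}" "q (l - 1) \<in> {t0..t}" "q l \<in> {t0..t}"
      using partition_range[OF p] partition_range[OF q] i(1) l by auto
    \<comment> \<open>Both ends of the interval enlarge the increment: a later right end gives a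
      larger set, and an earlier left end a smaller interior to remove.\<close>
    have "B \<omega> (q l) \<subseteq> B \<omega> (p i)" "B \<omega> (p (i - 1)) \<subseteq> B \<omega> (q (l - 1))"
      using range i(2,3) \<open>t \<le> T\<close> by (simp_all add: mono)
    then have "nucleation_increment B q l \<omega> \<subseteq> nucleation_increment B p i \<omega>"
      unfolding nucleation_increment_def using interior_mono by blast
    moreover have "aumann_integral t0 T (G \<omega>) (q (l - 1)) t
        \<subseteq> aumann_integral t0 T (G \<omega>) (p (i - 1)) t"
      using i(2) zero by (rule aumann_integral_antimono)
    ultimately have "nucleation_increment B q l \<omega> \<oplus>\<^sub>c aumann_integral t0 T (G \<omega>) (q (l - 1)) t
        \<subseteq> nucleation_increment B p i \<omega> \<oplus>\<^sub>c aumann_integral t0 T (G \<omega>) (p (i - 1)) t"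
      by (rule closed_minkowski_sum_mono)
    then show ?thesis
      unfolding upper_approx_def using i(1) by blast
  qed
  then show ?thesis
    unfolding upper_approx_def[of t0 T B G m] upper_approx_def[of t0 T B G n] by blast
qed

theorem proposition4p4:
  fixes M :: "'w measure" and F :: "real \<Rightarrow> 'w measure" and t0 T t :: real
    and B G :: "'w \<Rightarrow> real \<Rightarrow> 'a::{banach, second_countable_topology} set"
    and n m :: nat and p q :: "nat \<Rightarrow> real"
  assumes "reflexive_normed_space TYPE('a)"
    and "separable_dual TYPE('a)"
    and "filtered_complete_prob_space M F t0 T"
    and "nucleation_process M F t0 T B"
    and "growth_process M F t0 T G"
    and "t \<in> {t0..T}"
    and "is_partition t0 t n p"
    and "is_partition t0 t m q"
    and "is_refinement m q n p"
  shows "AE \<omega> in M. lower_approx t0 T B G n p t \<omega> \<subseteq> lower_approx t0 T B G m q t \<omega> \<and>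
                    upper_approx t0 T B G m q t \<omega> \<subseteq> upper_approx t0 T B G n p t \<omega>"
\<comment> \<open>The properties of \<open>B\<close> and \<open>G\<close> used here hold at every
  point of \<open>space M\<close>, so an arbitrary outcome can be fixed with no exceptional null
  set.\<close>
proof (rule AE_I2)
  fix \<omega>
  assume "\<omega> \<in> space M"
  have zero: "0 \<in> G \<omega> \<tau>" if "\<tau> \<in> {t0..T}" for \<tau>
    using assms(5) \<open>\<omega> \<in> space M\<close> that by (rule growth_process_zero)
  have mono: "B \<omega> r \<subseteq> B \<omega> s" if "t0 \<le> r" "r \<le> s" "s \<le> T" for r s
    using assms(4) \<open>\<omega> \<in> space M\<close> that by (rule nucleation_process_mono)
  have "t \<le> T"
    using assms(6) by simp
  show "lower_approx t0 T B G n p t \<omega> \<subseteq> lower_approx t0 T B G m q t \<omega> \<and>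
      upper_approx t0 T B G m q t \<omega> \<subseteq> upper_approx t0 T B G n p t \<omega>"
  proof
    show "lower_approx t0 T B G n p t \<omega> \<subseteq> lower_approx t0 T B G m q t \<omega>"
      using zero assms(8,9) by (rule lower_approx_refinement)
    show "upper_approx t0 T B G m q t \<omega> \<subseteq> upper_approx t0 T B G n p t \<omega>"
      using zero mono \<open>t \<le> T\<close> assms(7-9) by (rule upper_approx_refinement)
  qed
qed

end
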